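(* Let $(O_1)$ and $(O_2)$ be the internal circles of an arbelos, tangent to each other at $M$, let $(O)$ be its external circle, tangent to $(O_1)$ at $A_1$ and to $(O_2)$ at $A_2$, and fix one of the two open half-planes $H$ bounded by the line $O_1O_2$. For $i=1,2$, let $\mathcal E_i$ be the ellipse with foci $O$ and $O_i$ that has a vertex at $A_i$, and let $\mathcal P_i$ be the parabola with focus $O_i$ and vertex $M$. Then, for $i=1,2$, the center of the twin $\omega_i$ is the intersection point in $H$ of the ellipse $\mathcal E_i$ and the parabola $\mathcal P_i$.
   Context: Arbelos: $(O_1)$ and $(O_2)$ are circles with centers $O_1,O_2$ and radii $R_1,R_2>0$, externally tangent at the point $M$. The external circle $(O)$ has center $O$ on the line $O_1O_2$ and radius $R_1+R_2$, and is internally tangent to $(O_1)$ at $A_1$ and to $(O_2)$ at $A_2$, so that $A_1,O_1,M,O_2,A_2$ lie on one line in this order and $[A_1A_2]$ is a diameter of $(O)$. Let $l$ be the line through $M$ perpendicular to $O_1O_2$ (the common internal tangent of $(O_1)$ and $(O_2)$). Twins: for $i=1,2$, the twin $\omega_i$ is the circle with center in $H$, lying in the closed half-plane bounded by $l$ that contains $O_i$, which is tangent to $l$, externally tangent to $(O_i)$ and internally tangent to $(O)$. *)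

theory Defs
  imports "HOL-Analysis.Analysis"
begin

text \<open>
  The plane is \<^typ>\<open>real ^ 2\<close>; the circle with center \<open>c\<close> and radius \<open>r > 0\<close> is \<open>sphere c r\<close>.
  Tangency is the geometric notion (one common point, plus the relative position of the
  two disks), not an equation between distances and radii.
\<close>

definition ext_tangent_at ::
    "real ^ 2 \<Rightarrow> real \<Rightarrow> real ^ 2 \<Rightarrow> real \<Rightarrow> real ^ 2 \<Rightarrow> bool" where
  "ext_tangent_at c1 r1 c2 r2 T \<longleftrightarrow>
     sphere c1 r1 \<inter> sphere c2 r2 = {T} \<and> ball c1 r1 \<inter> ball c2 r2 = {}"

text \<open>The first circle lies inside the second one.\<close>

definition int_tangent_at ::
    "real ^ 2 \<Rightarrow> real \<Rightarrow> real ^ 2 \<Rightarrow> real \<Rightarrow> real ^ 2 \<Rightarrow> bool" where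
  "int_tangent_at c r C R T \<longleftrightarrow>
     sphere c r \<inter> sphere C R = {T} \<and> ball c r \<subseteq> ball C R"

definition tangent_to_line :: "real ^ 2 \<Rightarrow> real \<Rightarrow> (real ^ 2) set \<Rightarrow> bool" where
  "tangent_to_line c r l \<longleftrightarrow> (\<exists>T. sphere c r \<inter> l = {T})"

definition open_half_plane :: "(real ^ 2) set \<Rightarrow> (real ^ 2) set \<Rightarrow> bool" where
  "open_half_plane L H \<longleftrightarrow>
     (\<exists>n c. n \<noteq> 0 \<and> L = {x. n \<bullet> x = c} \<and> H = {x. n \<bullet> x > c})"

definition closed_half_plane :: "(real ^ 2) set \<Rightarrow> (real ^ 2) set \<Rightarrow> bool" where
  "closed_half_plane L K \<longleftrightarrow>
     (\<exists>n c. n \<noteq> 0 \<and> L = {x. n \<bullet> x = c} \<and> K = {x. n \<bullet> x \<ge> c})"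

text \<open>
  \<open>Z i\<close>, \<open>R i\<close> (for \<open>i = 1, 2\<close>) are the center and radius of the internal circles, \<open>M\<close> is their
  point of tangency, \<open>C\<close> is the center of the external circle, of radius \<open>R 1 + R 2\<close>, and \<open>A i\<close> is
  its point of tangency with the \<open>i\<close>-th internal circle.  The order of the points on the line
  of centers follows from these conditions.
\<close>

definition arbelos ::
    "(nat \<Rightarrow> real ^ 2) \<Rightarrow> (nat \<Rightarrow> real) \<Rightarrow> real ^ 2 \<Rightarrow> real ^ 2 \<Rightarrow> (nat \<Rightarrow> real ^ 2) \<Rightarrow> bool" where
  "arbelos Z R M C A \<longleftrightarrow>
     R 1 > 0 \<and> R 2 > 0 \<and>
     ext_tangent_at (Z 1) (R 1) (Z 2) (R 2) M \<and>
     C \<in> affine hull {Z 1, Z 2} \<and>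
     int_tangent_at (Z 1) (R 1) C (R 1 + R 2) (A 1) \<and>
     int_tangent_at (Z 2) (R 2) C (R 1 + R 2) (A 2)"

definition perp_line :: "real ^ 2 \<Rightarrow> real ^ 2 \<Rightarrow> real ^ 2 \<Rightarrow> (real ^ 2) set" where
  "perp_line M p q = {x. orthogonal (x - M) (q - p)}"

text \<open>\<open>w\<close> and \<open>r\<close> are the center and the radius of the \<open>i\<close>-th twin.\<close>

definition is_twin ::
    "(nat \<Rightarrow> real ^ 2) \<Rightarrow> (nat \<Rightarrow> real) \<Rightarrow> real ^ 2 \<Rightarrow> real ^ 2 \<Rightarrow> (real ^ 2) set \<Rightarrow> nat \<Rightarrow>
      real ^ 2 \<Rightarrow> real \<Rightarrow> bool" where
  "is_twin Z R M C H i w r \<longleftrightarrow>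
     r > 0 \<and> w \<in> H \<and>
     (\<exists>K. closed_half_plane (perp_line M (Z 1) (Z 2)) K \<and> Z i \<in> K \<and> sphere w r \<subseteq> K) \<and>
     tangent_to_line w r (perp_line M (Z 1) (Z 2)) \<and>
     (\<exists>T. ext_tangent_at w r (Z i) (R i) T) \<and>
     (\<exists>T. int_tangent_at w r C (R 1 + R 2) T)"

definition ellipse_with_foci :: "real ^ 2 \<Rightarrow> real ^ 2 \<Rightarrow> (real ^ 2) set \<Rightarrow> bool" where
  "ellipse_with_foci F1 F2 E \<longleftrightarrow>
     (\<exists>s. s > dist F1 F2 \<and> E = {x. dist x F1 + dist x F2 = s})"

text \<open>
  A vertex is a point of the ellipse on one of its two axes: the line through the foci or the
  perpendicular bisector of the foci.
\<close>

definition ellipse_vertex :: "real ^ 2 \<Rightarrow> real ^ 2 \<Rightarrow> (real ^ 2) set \<Rightarrow> real ^ 2 \<Rightarrow> bool" where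
  "ellipse_vertex F1 F2 E V \<longleftrightarrow>
     V \<in> E \<and> (V \<in> affine hull {F1, F2} \<or> dist V F1 = dist V F2)"

text \<open>
  The parabola with focus \<open>F\<close> and directrix \<open>d\<close>; its vertex \<open>V\<close> is its point on the axis, the line
  through \<open>F\<close> perpendicular to \<open>d\<close>.
\<close>

definition parabola_focus_vertex :: "real ^ 2 \<Rightarrow> real ^ 2 \<Rightarrow> (real ^ 2) set \<Rightarrow> bool" where
  "parabola_focus_vertex F V P \<longleftrightarrow>
     (\<exists>d. affine d \<and> aff_dim d = 1 \<and> F \<notin> d \<and> P = {x. dist x F = infdist x d} \<and>
          V \<in> P \<and> (\<forall>x\<in>d. \<forall>y\<in>d. orthogonal (V - F) (x - y)))"

text \<open>
  The rest of this theory shows that the configuration is never vacuous: the ellipse, the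
  parabola and the twin described above exist for every arbelos (lemmas \<open>ellipse_ex1\<close>,
  \<open>parabola_exists\<close> and \<open>twin_exists\<close>).
\<close>

context
  notes One_nat_def [simp del]
begin

lemma ext_tangent_dist:
  assumes "ext_tangent_at c1 r1 c2 r2 T" "r1 > 0" "r2 > 0"
  shows "dist c1 c2 = r1 + r2" "T = c1 + (r1 / (r1 + r2)) *\<^sub>R (c2 - c1)"
proof -
  have T: "dist c1 T = r1" "dist c2 T = r2" and d: "ball c1 r1 \<inter> ball c2 r2 = {}"
    using assms by (auto simp: ext_tangent_at_def)
  have "dist c1 c2 \<ge> r1 + r2"
  proof (rule ccontr)
    assume "\<not> ?thesis" then have lt: "dist c1 c2 < r1 + r2" by simp
    define t where "t = r1 / (r1 + r2)"
    define x where "x = c1 + t *\<^sub>R (c2 - c1)"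
    have t: "0 < t" "t < 1" using assms by (auto simp: t_def)
    have "dist c1 x = t * dist c1 c2" using t by (simp add: x_def dist_norm norm_minus_commute)
    also have "\<dots> < t * (r1 + r2)" using t lt by simp
    also have "\<dots> = r1" using assms by (simp add: t_def)
    finally have 1: "dist c1 x < r1" .
    have "c2 - x = (1 - t) *\<^sub>R (c2 - c1)" by (simp add: x_def algebra_simps)
    then have "dist c2 x = (1 - t) * dist c1 c2" using t by (simp add: dist_norm norm_minus_commute)
    also have "\<dots> < (1 - t) * (r1 + r2)" using t lt by simp
    also have "\<dots> = r2" using assms by (simp add: t_def field_simps)
    finally show False using 1 d by auto
  qed
  with T dist_triangle2[of c1 c2 T] show D: "dist c1 c2 = r1 + r2" by (simp add: dist_commute)
  have "dist c1 c2 = dist c1 T + dist T c2" using T D by (simp add: dist_commute)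
  then have "norm (c1 - T) *\<^sub>R (T - c2) = norm (T - c2) *\<^sub>R (c1 - T)"
    by (simp add: dist_triangle_eq)
  then have "r1 *\<^sub>R (T - c2) = r2 *\<^sub>R (c1 - T)" using T by (simp add: dist_norm norm_minus_commute)
  then have "(r1 + r2) *\<^sub>R T = (r1 + r2) *\<^sub>R c1 + r1 *\<^sub>R (c2 - c1)" by (simp add: algebra_simps)
  then have "(r1 + r2) *\<^sub>R T = (r1 + r2) *\<^sub>R (c1 + (r1 / (r1 + r2)) *\<^sub>R (c2 - c1))"
    using assms by (simp add: scaleR_add_right)
  then show "T = c1 + (r1 / (r1 + r2)) *\<^sub>R (c2 - c1)" using assms by simp
qed

lemma ext_tangentI:
  assumes D: "dist c1 c2 = r1 + r2" and r: "r1 > 0" "r2 > 0"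
  shows "ext_tangent_at c1 r1 c2 r2 (c1 + (r1 / (r1 + r2)) *\<^sub>R (c2 - c1))"
proof -
  define t where "t = r1 / (r1 + r2)"
  define T where "T = c1 + t *\<^sub>R (c2 - c1)"
  have t: "0 < t" "t < 1" using r by (auto simp: t_def)
  have 1: "dist c1 T = r1" using t r D by (simp add: T_def dist_norm norm_minus_commute t_def)
  have "c2 - T = (1 - t) *\<^sub>R (c2 - c1)" by (simp add: T_def algebra_simps)
  then have "norm (c2 - T) = (1 - t) * norm (c2 - c1)" using t by simp
  then have "dist c2 T = (1 - t) * (r1 + r2)" unfolding D[symmetric] by (metis dist_norm dist_commute)
  also have "1 - t = r2 / (r1 + r2)" using r by (simp add: t_def divide_simps)
  also have "r2 / (r1 + r2) * (r1 + r2) = r2" using r by simp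
  finally have 2: "dist c2 T = r2" .
  have "x = T" if x: "dist c1 x = r1" "dist c2 x = r2" for x
  proof -
    have "dist c1 c2 = dist c1 x + dist x c2" using x D by (simp add: dist_commute)
    then have "norm (c1 - x) *\<^sub>R (x - c2) = norm (x - c2) *\<^sub>R (c1 - x)"
      by (simp add: dist_triangle_eq)
    then have "r1 *\<^sub>R (x - c2) = r2 *\<^sub>R (c1 - x)" using x by (simp add: dist_norm norm_minus_commute)
    then have "(r1 + r2) *\<^sub>R x = (r1 + r2) *\<^sub>R c1 + r1 *\<^sub>R (c2 - c1)" by (simp add: algebra_simps)
    then have "(r1 + r2) *\<^sub>R x = (r1 + r2) *\<^sub>R T"
      using r by (simp add: scaleR_add_right T_def t_def)
    then show ?thesis using r by simp
  qed
  with 1 2 have "sphere c1 r1 \<inter> sphere c2 r2 = {T}" unfolding sphere_def by blast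
  moreover have "ball c1 r1 \<inter> ball c2 r2 = {}" using D by (simp add: disjoint_ballI)
  ultimately show ?thesis by (simp add: ext_tangent_at_def T_def t_def)
qed

lemma int_tangent_dist:
  assumes "int_tangent_at c r C R T" "r > 0" "r < R"
  shows "dist c C = R - r" "T = C + (R / (R - r)) *\<^sub>R (c - C)"
proof -
  have T: "dist c T = r" "dist C T = R" and d: "dist c C + r \<le> R"
    using assms by (auto simp: int_tangent_at_def ball_subset_ball_iff)
  with dist_triangle[of C T c] show D: "dist c C = R - r" by (simp add: dist_commute)
  have "dist C T = dist C c + dist c T" using T D by (simp add: dist_commute)
  then have "norm (C - c) *\<^sub>R (c - T) = norm (c - T) *\<^sub>R (C - c)"
    by (simp add: dist_triangle_eq)
  then have "(R - r) *\<^sub>R (c - T) = r *\<^sub>R (C - c)" using T D by (simp add: dist_norm norm_minus_commute)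
  then have "(R - r) *\<^sub>R T = (R - r) *\<^sub>R C + R *\<^sub>R (c - C)" by (simp add: algebra_simps)
  then have "(R - r) *\<^sub>R T = (R - r) *\<^sub>R (C + (R / (R - r)) *\<^sub>R (c - C))"
    using assms by (simp add: scaleR_add_right)
  then show "T = C + (R / (R - r)) *\<^sub>R (c - C)" using assms by simp
qed

lemma int_tangentI:
  assumes D: "dist c C = R - r" and r: "r > 0" "r < R"
  shows "int_tangent_at c r C R (C + (R / (R - r)) *\<^sub>R (c - C))"
proof -
  define t where "t = R / (R - r)"
  define T where "T = C + t *\<^sub>R (c - C)"
  have t: "1 < t" using r by (auto simp: t_def)
  have 1: "dist C T = R" using t r D by (simp add: T_def dist_norm norm_minus_commute t_def)
  have "T - c = (t - 1) *\<^sub>R (c - C)" by (simp add: T_def algebra_simps)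
  then have "norm (T - c) = (t - 1) * norm (c - C)" using t by simp
  then have "dist c T = (t - 1) * (R - r)" unfolding D[symmetric] by (metis dist_norm dist_commute)
  also have "t - 1 = r / (R - r)" using r by (simp add: t_def diff_divide_distrib divide_simps)
  also have "r / (R - r) * (R - r) = r" using r by simp
  finally have 2: "dist c T = r" .
  have "x = T" if x: "dist c x = r" "dist C x = R" for x
  proof -
    have "dist C x = dist C c + dist c x" using x D by (simp add: dist_commute)
    then have "norm (C - c) *\<^sub>R (c - x) = norm (c - x) *\<^sub>R (C - c)"
      by (simp add: dist_triangle_eq)
    then have "(R - r) *\<^sub>R (c - x) = r *\<^sub>R (C - c)" using x D by (simp add: dist_norm norm_minus_commute)
    then have "(R - r) *\<^sub>R x = (R - r) *\<^sub>R C + R *\<^sub>R (c - C)" by (simp add: algebra_simps)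
    then have "(R - r) *\<^sub>R x = (R - r) *\<^sub>R T"
      using r by (simp add: scaleR_add_right T_def t_def)
    then show ?thesis using r by simp
  qed
  with 1 2 have "sphere c r \<inter> sphere C R = {T}" unfolding sphere_def by blast
  moreover have "ball c r \<subseteq> ball C R" using D r by (simp add: ball_subset_ball_iff)
  ultimately show ?thesis by (simp add: int_tangent_at_def T_def t_def)
qed

lemma infdist_hyperplane:
  fixes n x :: "real ^ 2"
  assumes n: "norm n = 1"
  shows "infdist x {y. n \<bullet> y = c} = \<bar>n \<bullet> x - c\<bar>"
proof -
  let ?S = "{y. n \<bullet> y = c}"
  let ?p = "x - (n \<bullet> x - c) *\<^sub>R n"
  have nn: "n \<bullet> n = 1" using n by (simp add: norm_eq_1)
  have p: "?p \<in> ?S" by (simp add: inner_diff_right nn)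
  have le: "\<bar>n \<bullet> x - c\<bar> \<le> dist x y" if "y \<in> ?S" for y
    using that Cauchy_Schwarz_ineq2[of n "x - y"] n by (simp add: dist_norm inner_diff_right)
  have "infdist x ?S \<le> dist x ?p" by (rule infdist_le[OF p])
  moreover have "dist x ?p = \<bar>n \<bullet> x - c\<bar>" using n by (simp add: dist_norm)
  moreover have "\<bar>n \<bullet> x - c\<bar> \<le> infdist x ?S"
    using p by (subst infdist_notempty) (auto intro!: cINF_greatest le[simplified])
  ultimately show ?thesis by linarith
qed

lemma arbelos_coords:
  assumes "arbelos Z R M C A"
  obtains u where "norm u = 1" "Z 1 = M + R 1 *\<^sub>R u" "Z 2 = M - R 2 *\<^sub>R u"
    "C = M + (R 1 - R 2) *\<^sub>R u" "A 1 = M + (2 * R 1) *\<^sub>R u" "A 2 = M - (2 * R 2) *\<^sub>R u"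
    "R 1 > 0" "R 2 > 0"
proof -
  have r: "R 1 > 0" "R 2 > 0" using assms by (auto simp: arbelos_def)
  let ?s = "R 1 + R 2"
  have e: "dist (Z 1) (Z 2) = ?s" "M = Z 1 + (R 1 / ?s) *\<^sub>R (Z 2 - Z 1)"
    using ext_tangent_dist[OF _ r] assms by (auto simp: arbelos_def)
  have i1: "dist (Z 1) C = R 2" "A 1 = C + (?s / R 2) *\<^sub>R (Z 1 - C)"
    using int_tangent_dist[of "Z 1" "R 1" C ?s "A 1"] r assms by (auto simp: arbelos_def)
  have i2: "dist (Z 2) C = R 1" "A 2 = C + (?s / R 1) *\<^sub>R (Z 2 - C)"
    using int_tangent_dist[of "Z 2" "R 2" C ?s "A 2"] r assms by (auto simp: arbelos_def)
  define u where "u = (1 / ?s) *\<^sub>R (Z 1 - Z 2)"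
  have nu: "norm u = 1" using e(1) r by (simp add: u_def dist_norm)
  have d: "Z 1 - Z 2 = ?s *\<^sub>R u" using r by (simp add: u_def)
  have "M = Z 1 - (R 1 / ?s) *\<^sub>R (Z 1 - Z 2)" using e(2) by (simp add: algebra_simps)
  then have z1: "Z 1 = M + R 1 *\<^sub>R u" using r by (simp add: d)
  have "Z 2 = Z 1 - ?s *\<^sub>R u" using d by (simp add: algebra_simps)
  then have z2: "Z 2 = M - R 2 *\<^sub>R u" using z1 by (simp add: algebra_simps)
  have "dist (Z 1) (Z 2) = dist (Z 1) C + dist C (Z 2)" using e i1 i2 by (simp add: dist_commute)
  then have "norm (Z 1 - C) *\<^sub>R (C - Z 2) = norm (C - Z 2) *\<^sub>R (Z 1 - C)" by (simp add: dist_triangle_eq)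
  then have "R 2 *\<^sub>R (C - Z 2) = R 1 *\<^sub>R (Z 1 - C)" using i1 i2 by (simp add: dist_norm norm_minus_commute)
  then have "?s *\<^sub>R C = ?s *\<^sub>R (M + (R 1 - R 2) *\<^sub>R u)" unfolding z1 z2 by (simp add: algebra_simps)
  then have c: "C = M + (R 1 - R 2) *\<^sub>R u" using r by simp
  have "Z 1 - C = R 2 *\<^sub>R u" "Z 2 - C = - R 1 *\<^sub>R u" by (simp_all add: c z1 z2 algebra_simps)
  then have "A 1 = C + ?s *\<^sub>R u" "A 2 = C - ?s *\<^sub>R u" using i1(2) i2(2) r by simp_all
  then have a: "A 1 = M + (2 * R 1) *\<^sub>R u" "A 2 = M - (2 * R 2) *\<^sub>R u"
    by (simp_all add: c vec_eq_iff algebra_simps)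
  show ?thesis by (rule that[OF nu z1 z2 c a r])
qed

lemma arbelos_frame:
  assumes arb: "arbelos Z R M C A" and H: "open_half_plane (affine hull {Z 1, Z 2}) H"
    and i: "i \<in> {1, 2}"
  obtains u v b where "norm u = 1" "norm v = 1" "u \<bullet> v = 0" "R i > 0" "b > 0"
    "R 1 + R 2 = R i + b" "Z i = M + R i *\<^sub>R u" "C = M + (R i - b) *\<^sub>R u"
    "A i = M + (2 * R i) *\<^sub>R u" "perp_line M (Z 1) (Z 2) = {x. u \<bullet> x = u \<bullet> M}"
    "H = {x. (x - M) \<bullet> v > 0}"
proof -
  obtain u where u: "norm u = 1" "Z 1 = M + R 1 *\<^sub>R u" "Z 2 = M - R 2 *\<^sub>R u"
    "C = M + (R 1 - R 2) *\<^sub>R u" "A 1 = M + (2 * R 1) *\<^sub>R u" "A 2 = M - (2 * R 2) *\<^sub>R u"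
    "R 1 > 0" "R 2 > 0" using arbelos_coords[OF arb] by blast
  have d: "Z 2 - Z 1 = - (R 1 + R 2) *\<^sub>R u" by (simp add: u algebra_simps)
  obtain n c where n: "n \<noteq> 0" "affine hull {Z 1, Z 2} = {x. n \<bullet> x = c}" "H = {x. n \<bullet> x > c}"
    using H by (auto simp: open_half_plane_def)
  have "Z 1 \<in> affine hull {Z 1, Z 2}" "Z 2 \<in> affine hull {Z 1, Z 2}" by (auto intro: hull_inc)
  then have z: "n \<bullet> Z 1 = c" "n \<bullet> Z 2 = c" using n by auto
  then have "n \<bullet> (Z 2 - Z 1) = 0" by (simp add: inner_diff_right)
  then have nu: "n \<bullet> u = 0" using u(7,8) unfolding d by (simp del: scaleR_minus_left)
  have nM: "n \<bullet> M = c" using z(1) nu by (simp add: u inner_add_right)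
  define v where "v = (1 / norm n) *\<^sub>R n"
  have v: "norm v = 1" "u \<bullet> v = 0" using n(1) nu by (simp_all add: v_def inner_commute)
  have "(x - M) \<bullet> v = (n \<bullet> x - c) / norm n" for x
    by (simp add: v_def nM[symmetric] inner_diff_left inner_diff_right inner_commute)
  then have "(x - M) \<bullet> v > 0 \<longleftrightarrow> n \<bullet> x > c" for x
    using n(1) by (simp add: zero_less_divide_iff)
  then have hv: "H = {x. (x - M) \<bullet> v > 0}" using n by auto
  have l: "perp_line M (Z 1) (Z 2) = {x. u \<bullet> x = u \<bullet> M}"
    using u(7,8) unfolding perp_line_def d orthogonal_def inner_scaleR_right
    by (auto simp: inner_diff_left inner_diff_right inner_commute)
  show ?thesis
  proof (cases "i = 1")
    case True
    then show ?thesis using that[of u v "R 2"] u v l hv by simp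
  next
    case False
    then have 2: "i = 2" using i by simp
    show ?thesis
    proof (rule that[of "- u" v "R 1"])
      show "C = M + (R i - R 1) *\<^sub>R (- u)" by (simp add: 2 u(4) algebra_simps)
      show "perp_line M (Z 1) (Z 2) = {x. (- u) \<bullet> x = (- u) \<bullet> M}" by (simp add: l)
      show "H = {x. (x - M) \<bullet> v > 0}" by (rule hv)
    qed (simp_all add: 2 u(1,3,6,7,8) v)
  qed
qed

lemma ellipse_ex1:
  assumes "arbelos Z R M C A" "open_half_plane (affine hull {Z 1, Z 2}) H" "i \<in> {1, 2}"
  shows "\<exists>!E. ellipse_with_foci C (Z i) E \<and> ellipse_vertex C (Z i) E (A i)"
proof -
  obtain u v b where f: "norm u = 1" "R i > 0" "b > 0" "Z i = M + R i *\<^sub>R u"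
    "C = M + (R i - b) *\<^sub>R u" "A i = M + (2 * R i) *\<^sub>R u"
    by (rule arbelos_frame[OF assms])
  have ac: "A i - C = (R i + b) *\<^sub>R u" and az: "A i - Z i = R i *\<^sub>R u" and cz: "C - Z i = - b *\<^sub>R u"
    by (simp_all add: f algebra_simps flip: scaleR_add_left)
  have "A i = (- (R i / b)) *\<^sub>R C + (1 + R i / b) *\<^sub>R Z i"
    using f(2,3) by (simp add: f(4-6) vec_eq_iff field_simps)
  moreover have "- (R i / b) + (1 + R i / b) = 1" by simp
  ultimately have "A i \<in> affine hull {C, Z i}" unfolding affine_hull_2 by blast
  moreover have "dist (A i) C + dist (A i) (Z i) > dist C (Z i)" using f(1-3) by (simp add: dist_norm ac az cz)
  ultimately show ?thesis unfolding ellipse_with_foci_def ellipse_vertex_def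
    by (intro ex1I[of _ "{x. dist x C + dist x (Z i) = dist (A i) C + dist (A i) (Z i)}"]) auto
qed

lemma parabola_exists:
  assumes "F \<noteq> V"
  shows "\<exists>P. parabola_focus_vertex F V P"
proof -
  define n where "n = (1 / norm (F - V)) *\<^sub>R (F - V)"
  define a where "a = norm (F - V)"
  have a: "a > 0" using assms by (simp add: a_def)
  have n: "norm n = 1" and F: "F = V + a *\<^sub>R n" using assms by (simp_all add: n_def a_def)
  have nn: "n \<bullet> n = 1" using n by (simp add: norm_eq_1)
  let ?d = "{y. n \<bullet> y = n \<bullet> V - a}"
  have "aff_dim ?d = 1" using n by (subst aff_dim_hyperplane) auto
  moreover have "affine ?d" by (rule affine_hyperplane)
  moreover have "F \<notin> ?d" using a by (simp add: F inner_add_right nn)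
  moreover have "dist V F = infdist V ?d" using a n by (simp add: infdist_hyperplane F dist_norm)
  moreover have "\<forall>x\<in>?d. \<forall>y\<in>?d. orthogonal (V - F) (x - y)"
    by (simp add: F orthogonal_def inner_diff_right)
  ultimately show ?thesis unfolding parabola_focus_vertex_def
    by (intro exI[of _ "{x. dist x F = infdist x ?d}"] exI[of _ ?d]) auto
qed

lemma twin_exists:
  assumes "arbelos Z R M C A" "open_half_plane (affine hull {Z 1, Z 2}) H" "i \<in> {1, 2}"
  shows "\<exists>w r. is_twin Z R M C H i w r"
proof -
  obtain u v b where f: "norm u = 1" "norm v = 1" "u \<bullet> v = 0" "R i > 0" "b > 0"
    "R 1 + R 2 = R i + b" "Z i = M + R i *\<^sub>R u" "C = M + (R i - b) *\<^sub>R u"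
    "perp_line M (Z 1) (Z 2) = {x. u \<bullet> x = u \<bullet> M}"
    "H = {x. (x - M) \<bullet> v > 0}"
    by (rule arbelos_frame[OF assms])
  have uu: "u \<bullet> u = 1" and vv: "v \<bullet> v = 1" and vu: "v \<bullet> u = 0"
    using f(1-3) by (simp_all add: norm_eq_1 inner_commute)
  define a where "a = R i"
  define r where "r = a * b / (a + b)"
  define h where "h = 2 * sqrt (a * r)"
  define w where "w = M + r *\<^sub>R u + h *\<^sub>R v"
  have a: "a > 0" "b > 0" using f by (simp_all add: a_def)
  have r: "r > 0" "r * (a + b) = a * b" using a by (simp_all add: r_def)
  have h: "h > 0" "h\<^sup>2 = 4 * a * r" using a r by (simp_all add: h_def power_mult_distrib)
  have rlt: "r < a + b" 
  proof -
    have "a * b < (a + b) * (a + b)" using a by (simp add: algebra_simps add_pos_pos)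
    then show ?thesis using a by (simp add: r_def field_simps)
  qed
  have nrm: "norm (x *\<^sub>R u + y *\<^sub>R v) = z" if "z > 0" "z\<^sup>2 = x\<^sup>2 + y\<^sup>2" for x y z :: real
  proof -
    have "(norm (x *\<^sub>R u + y *\<^sub>R v))\<^sup>2 = z\<^sup>2"
      unfolding that(2) power2_norm_eq_inner
      by (simp add: inner_add_left inner_add_right uu vv vu f(3) power2_eq_square)
    then show ?thesis using that(1) by (simp add: power2_eq_iff_nonneg)
  qed
  have "w - Z i = (r - a) *\<^sub>R u + h *\<^sub>R v" by (simp add: w_def f(7) a_def algebra_simps)
  moreover have "(r + a)\<^sup>2 = (r - a)\<^sup>2 + h\<^sup>2" using h(2) by (simp add: power2_eq_square algebra_simps)
  ultimately have dz: "dist w (Z i) = r + R i" unfolding dist_norm a_def[symmetric]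
    using nrm[of "r + a" "r - a" h] r a by simp
  have "w - C = (r - a + b) *\<^sub>R u + h *\<^sub>R v" by (simp add: w_def f(8) a_def algebra_simps)
  moreover have "(a + b - r)\<^sup>2 = (r - a + b)\<^sup>2 + h\<^sup>2" using r(2) h(2) by (simp add: power2_eq_square algebra_simps)
  ultimately have dC: "dist w C = (R 1 + R 2) - r" unfolding dist_norm f(6)
    using nrm[of "a + b - r" "r - a + b" h] rlt by (simp add: a_def)
  have uw: "u \<bullet> w = u \<bullet> M + r" by (simp add: w_def inner_add_right uu f(3))
  have "sphere w r \<inter> {x. u \<bullet> x = u \<bullet> M} = {w - r *\<^sub>R u}"
  proof (intro equalityI subsetI)
    fix x assume "x \<in> sphere w r \<inter> {x. u \<bullet> x = u \<bullet> M}"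
    then have x: "norm (w - x) = r" "u \<bullet> (w - x) = r" using uw by (auto simp: dist_norm inner_diff_right)
    have "(norm (w - x - r *\<^sub>R u))\<^sup>2 = (norm (w - x))\<^sup>2 - 2 * r * (u \<bullet> (w - x)) + r\<^sup>2"
      unfolding power2_norm_eq_inner
      by (simp add: inner_diff_left inner_diff_right uu inner_commute algebra_simps power2_eq_square)
    then have "norm (w - x - r *\<^sub>R u) = 0" using x by (simp add: power2_eq_square)
    then show "x \<in> {w - r *\<^sub>R u}" by (simp add: algebra_simps)
  qed (use uw r f(1) uu in \<open>auto simp: dist_norm inner_diff_right\<close>)
  then have tl: "tangent_to_line w r (perp_line M (Z 1) (Z 2))" by (auto simp: tangent_to_line_def f(9))
  have "u \<bullet> x \<ge> u \<bullet> M" if "x \<in> sphere w r" for x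
    using that Cauchy_Schwarz_ineq2[of u "w - x"] f(1) uw by (simp add: dist_norm inner_diff_right)
  moreover have "u \<bullet> Z i \<ge> u \<bullet> M" using f(4) by (simp add: f(7) inner_add_right uu)
  moreover have "u \<noteq> 0" using f(1) by auto
  ultimately have K: "\<exists>K. closed_half_plane (perp_line M (Z 1) (Z 2)) K \<and> Z i \<in> K \<and> sphere w r \<subseteq> K"
    unfolding closed_half_plane_def f(9)
    by (intro exI[of _ "{x. u \<bullet> x \<ge> u \<bullet> M}"] conjI exI[of _ u] exI[of _ "u \<bullet> M"]) auto
  have "w \<in> H" using h by (simp add: f(10) w_def inner_add_left f(3) vv)
  then have "is_twin Z R M C H i w r" unfolding is_twin_def
    using r(1) K tl ext_tangentI[OF dz r(1) f(4)] int_tangentI[OF dC r(1)] rlt f(6)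
    by (auto simp: a_def)
  then show ?thesis by blast
qed

end

end

theory Submission
  imports Defs
begin

text \<open>
  Write \<open>a\<close> for the radius of the \<open>i\<close>-th internal circle and \<open>b\<close> for that of the other one, let \<open>u\<close> be
  the unit vector from \<open>M\<close> towards \<open>Z i\<close>, and let \<open>l\<close> be the common tangent at \<open>M\<close>.

  That the twin's center lies on both conics is a matter of adding up radii.  A twin with center
  \<open>w\<close> and radius \<open>r\<close> has distance \<open>r\<close> from \<open>l\<close>, distance \<open>a + r\<close> from \<open>Z i\<close> and distance
  \<open>a + b - r\<close> from \<open>C\<close>.  The sum of the last two is \<open>2 * a + b\<close>, which does not depend on \<open>r\<close> and
  is also the sum for \<open>A i\<close>; so \<open>w\<close> is on the ellipse.  The directrix of the parabola is the
  translate of \<open>l\<close> by \<open>a\<close> away from the focus \<open>Z i\<close>, so its distance from \<open>w\<close> is \<open>r + a\<close>, which is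
  the distance of \<open>w\<close> from the focus; so \<open>w\<close> is on the parabola.

  That there is no other common point in the half-plane comes from the shared focus \<open>Z i\<close>.  With
  coordinates \<open>p\<close> along \<open>l\<close>'s normal \<open>u\<close> and \<open>q\<close> along \<open>l\<close>, the parabola is \<open>q\<^sup>2 = 4 * a * p\<close>, and
  on it the distance to \<open>Z i\<close> is the linear function \<open>p + a\<close>.  Substituting this
  into the equation of the ellipse leaves one linear equation for \<open>p\<close>, with solution
  \<open>p = a * b / (a + b)\<close> (\<open>parabola_ellipse_coords\<close>).  Then \<open>q\<close> is determined up to its sign, which
  the half-plane fixes.
\<close>

section \<open>Lines and half-planes\<close>

text \<open>
  Reflection in the normal of the line through \<open>w\<close> preserves the circle and the line, so it must
  fix their only common point, which is therefore the foot of that normal.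
\<close>

lemma tangent_to_line_dist:
  assumes u: "norm u = 1" and t: "tangent_to_line w r {x. u \<bullet> x = c}"
  shows "\<bar>u \<bullet> w - c\<bar> = r"
proof -
  obtain T where T: "sphere w r \<inter> {x. u \<bullet> x = c} = {T}"
    using t by (auto simp: tangent_to_line_def)
  then have T': "norm (w - T) = r" "u \<bullet> T = c" by (auto simp: dist_norm)
  have uu: "u \<bullet> u = 1" using u by (simp add: norm_eq_1)
  define k where "k = u \<bullet> w - c"
  define p where "p = w - k *\<^sub>R u"
  define S where "S = 2 *\<^sub>R p - T"
  have pT: "u \<bullet> (p - T) = 0" using T'(2) by (simp add: p_def k_def uu inner_diff_right)
  have wS: "w - S = k *\<^sub>R u - (p - T)" and wT: "w - T = k *\<^sub>R u + (p - T)"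
    by (simp_all add: S_def p_def scaleR_2)
  have "(norm (w - S))\<^sup>2 = (norm (w - T))\<^sup>2"
    unfolding wS wT power2_norm_eq_inner using pT
    by (simp add: inner_add_left inner_add_right inner_diff_left[of "k *\<^sub>R u"]
        inner_diff_right[of _ "k *\<^sub>R u"] inner_commute[of "p - T" u])
  then have "norm (w - S) = r" using T'(1) by (metis norm_ge_zero power2_eq_imp_eq)
  moreover have "u \<bullet> S = c"
    using pT T'(2) by (simp add: S_def inner_diff_right)
  ultimately have "S \<in> sphere w r \<inter> {x. u \<bullet> x = c}" by (simp add: dist_norm)
  with T have "S = T" by auto
  then have "2 *\<^sub>R p = 2 *\<^sub>R T" by (simp add: S_def scaleR_2 algebra_simps)
  then have "p = T" by simp
  then have "w - T = k *\<^sub>R u" by (simp add: p_def flip: \<open>p = T\<close>)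
  then show ?thesis using T'(1) u by (simp add: k_def)
qed

text \<open>
  The normal \<open>n\<close> that defines \<open>K\<close> is not related to \<open>u\<close> beforehand.  But if \<open>w\<close> were strictly
  on the other side of the line, the segment from \<open>w\<close> to \<open>z\<close> would cross it, although \<open>n\<close> takes
  at both ends, hence on the whole segment, larger values than on the line.
\<close>

lemma closed_half_plane_same_side:
  assumes K: "closed_half_plane {x. u \<bullet> x = c} K" and z: "z \<in> K" "u \<bullet> z > c" and w: "w \<in> K"
  shows "u \<bullet> w \<ge> c"
proof (rule ccontr)
  assume "\<not> ?thesis"
  then have wc: "u \<bullet> w < c" by simp
  obtain n e where n: "\<And>x. u \<bullet> x = c \<longleftrightarrow> n \<bullet> x = e" and Ke: "K = {x. n \<bullet> x \<ge> e}"
    using K by (auto simp: closed_half_plane_def set_eq_iff)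
  have nz: "n \<bullet> z > e" using z n[of z] by (auto simp: Ke)
  have nw: "n \<bullet> w > e" using w wc n[of w] by (auto simp: Ke)
  define t where "t = (c - u \<bullet> w) / (u \<bullet> z - u \<bullet> w)"
  have t: "0 < t" "t < 1" using z(2) wc by (auto simp: t_def)
  define x where "x = (1 - t) *\<^sub>R w + t *\<^sub>R z"
  have "u \<bullet> x = u \<bullet> w + t * (u \<bullet> z - u \<bullet> w)" by (simp add: x_def inner_add_right algebra_simps)
  also have "\<dots> = c" using z(2) wc by (simp add: t_def)
  finally have "n \<bullet> x = e" using n by simp
  moreover have "n \<bullet> x - e = (1 - t) * (n \<bullet> w - e) + t * (n \<bullet> z - e)"
    by (simp add: x_def inner_add_right algebra_simps)
  moreover have "(1 - t) * (n \<bullet> w - e) > 0" "t * (n \<bullet> z - e) > 0" using t nz nw by auto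
  ultimately show False by linarith
qed

lemma center_in_closed_half_plane:
  fixes u :: "real ^ 2"
  assumes K: "closed_half_plane L K" and s: "sphere w r \<subseteq> K" and u: "norm u = 1" and r: "r > 0"
  shows "w \<in> K"
proof -
  obtain n e where Ke: "K = {x. n \<bullet> x \<ge> e}" using K by (auto simp: closed_half_plane_def)
  have "w + r *\<^sub>R u \<in> K" "w - r *\<^sub>R u \<in> K" using s u r by (auto simp: dist_norm)
  then show ?thesis by (simp add: Ke inner_add_right inner_diff_right)
qed

section \<open>The parabola and its equation\<close>

text \<open>
  The orthogonality condition puts the directrix inside a line with normal \<open>u\<close>, and a dimension
  count makes them equal.  That \<open>V\<close> is on the curve leaves two positions for the directrix, at
  distance \<open>a\<close> from \<open>V\<close>; one of them passes through the focus.
\<close>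

lemma parabola_eq:
  assumes P: "parabola_focus_vertex F V P" and F: "F = V + a *\<^sub>R u" and a: "a > 0"
    and u: "norm u = 1"
  shows "P = {x. dist x F = \<bar>u \<bullet> x - u \<bullet> V + a\<bar>}"
proof -
  obtain d where d: "affine d" "aff_dim d = 1" "F \<notin> d" "P = {x. dist x F = infdist x d}"
      "V \<in> P" "\<forall>x\<in>d. \<forall>y\<in>d. orthogonal (V - F) (x - y)"
    using P by (auto simp: parabola_focus_vertex_def)
  have uu: "u \<bullet> u = 1" using u by (simp add: norm_eq_1)
  have "d \<noteq> {}" using d(2) by auto
  then obtain y where y: "y \<in> d" by blast
  have "u \<bullet> x = u \<bullet> y" if "x \<in> d" for x
  proof -
    have "orthogonal (V - F) (x - y)" using d(6) that y by blast
    then show ?thesis using a by (simp add: F orthogonal_def inner_diff_right)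
  qed
  then have "d \<subseteq> {x. u \<bullet> x = u \<bullet> y}" by auto
  moreover have "aff_dim {x. u \<bullet> x = u \<bullet> y} = 1" using u by (subst aff_dim_hyperplane) auto
  ultimately have deq: "d = {x. u \<bullet> x = u \<bullet> y}"
    using d(1,2) \<open>d \<noteq> {}\<close> affine_hyperplane by (intro affine_dim_equal) simp_all
  have inf: "infdist x d = \<bar>u \<bullet> x - u \<bullet> y\<bar>" for x
    unfolding deq by (rule infdist_hyperplane[OF u])
  have "dist V F = infdist V d" using d(4,5) by simp
  then have "a = \<bar>u \<bullet> V - u \<bullet> y\<bar>"
    unfolding inf using a u by (simp add: F dist_norm)
  moreover have "u \<bullet> V + a \<noteq> u \<bullet> y"
    using d(3) by (simp add: deq F inner_add_right uu)
  ultimately have "u \<bullet> y = u \<bullet> V - a" by linarith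
  then have "infdist x d = \<bar>u \<bullet> x - u \<bullet> V + a\<bar>" for x unfolding inf by linarith
  then show ?thesis unfolding d(4) by simp
qed

section \<open>Intersection of the two conics in coordinates\<close>

lemma orthonormal_expansion_2:
  fixes u v x :: "real ^ 2"
  assumes "norm u = 1" "norm v = 1" "u \<bullet> v = 0"
  shows "x = (x \<bullet> u) *\<^sub>R u + (x \<bullet> v) *\<^sub>R v"
proof -
  have uv: "u \<noteq> v" using assms by (auto simp: norm_eq_1)
  have orth: "pairwise orthogonal {u, v}"
    using assms(3) by (auto simp: pairwise_insert orthogonal_def inner_commute)
  have "0 \<notin> {u, v}" using assms by auto
  with orth have ind: "independent {u, v}" by (rule pairwise_orthogonal_independent)
  have "span {u, v} = UNIV"
    using card_ge_dim_independent[OF subset_UNIV ind] uv by auto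
  then have "(\<Sum>b\<in>{u, v}. (x \<bullet> b) *\<^sub>R b) = x"
    using orth assms(1,2) by (intro orthonormal_basis_expand) auto
  then show ?thesis using uv by simp
qed

lemma norm_orthonormal_combination:
  fixes u v :: "'a::real_inner"
  assumes "norm u = 1" "norm v = 1" "u \<bullet> v = 0"
  shows "(norm (p *\<^sub>R u + q *\<^sub>R v))\<^sup>2 = p\<^sup>2 + q\<^sup>2"
  using assms unfolding power2_norm_eq_inner
  by (simp add: inner_add_left inner_add_right norm_eq_1 inner_commute[of v u] power2_eq_square)

text \<open>
  Here \<open>f\<close> and \<open>g\<close> stand for the distances of the point \<open>(p, q)\<close> from the common focus \<open>(a, 0)\<close>
  and from the other focus \<open>(a - b, 0)\<close> of the ellipse; the conic equations are \<open>f = \<bar>p + a\<bar>\<close> and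
  \<open>g + f = 2 * a + b\<close>.
\<close>

lemma parabola_ellipse_coords:
  fixes a b p q f g :: real
  assumes a: "a > 0" and b: "b > 0"
    and f: "f\<^sup>2 = (p - a)\<^sup>2 + q\<^sup>2" and g: "g\<^sup>2 = (p - (a - b))\<^sup>2 + q\<^sup>2"
    and par: "f = \<bar>p + a\<bar>" and ell: "g + f = 2 * a + b"
  shows "p = a * b / (a + b)" and "q\<^sup>2 = 4 * a * p"
proof -
  show q: "q\<^sup>2 = 4 * a * p"
    using f unfolding par by (simp add: power2_eq_square algebra_simps)
  \<comment> \<open>The parabola lies on the focus side of its vertex tangent, so the absolute value drops.\<close>
  have "4 * a * p \<ge> 0" unfolding q[symmetric] by simp
  then have "p \<ge> 0" using a by (simp add: zero_le_mult_iff)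
  then have "g = a + b - p" using par ell a by simp
  with g have "(a + b - p)\<^sup>2 = (p - (a - b))\<^sup>2 + 4 * a * p" unfolding q by simp
  then have "(a + b) * p = a * b" by (simp add: power2_eq_square algebra_simps)
  then show "p = a * b / (a + b)" using a b by (simp add: field_simps)
qed

section \<open>The twin's center\<close>

theorem proposition1:
  fixes Z A :: "nat \<Rightarrow> real ^ 2" and R :: "nat \<Rightarrow> real" and M C w :: "real ^ 2"
    and H E P :: "(real ^ 2) set" and r :: real and i :: nat
  assumes "arbelos Z R M C A"
    and "open_half_plane (affine hull {Z 1, Z 2}) H"
    and "i \<in> {1, 2}"
    and "ellipse_with_foci C (Z i) E" and "ellipse_vertex C (Z i) E (A i)"
    and "parabola_focus_vertex (Z i) M P"
    and "is_twin Z R M C H i w r"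
  shows "E \<inter> P \<inter> H = {w}"
proof -
  obtain u v b where fr: "norm u = 1" "norm v = 1" "u \<bullet> v = 0" "R i > 0" "b > 0"
    "R 1 + R 2 = R i + b" "Z i = M + R i *\<^sub>R u" "C = M + (R i - b) *\<^sub>R u"
    "A i = M + (2 * R i) *\<^sub>R u" "perp_line M (Z 1) (Z 2) = {x. u \<bullet> x = u \<bullet> M}"
    "H = {x. (x - M) \<bullet> v > 0}"
    by (rule arbelos_frame[OF assms(1-3)])
  define a where "a = R i"
  have a: "a > 0" using fr(4) by (simp add: a_def)
  have Z: "Z i = M + a *\<^sub>R u" and C: "C = M + (a - b) *\<^sub>R u" by (simp_all add: fr(7,8) a_def)

  have "A i - C = (a + b) *\<^sub>R u" "A i - Z i = a *\<^sub>R u"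
    by (simp_all add: fr(9) C Z a_def algebra_simps flip: scaleR_add_left)
  then have "dist (A i) C + dist (A i) (Z i) = 2 * a + b"
    using a fr(1,5) by (simp add: dist_norm)
  then have E: "E = {x. dist x C + dist x (Z i) = 2 * a + b}"
    using assms(4,5) by (auto simp: ellipse_with_foci_def ellipse_vertex_def)
  have P: "P = {x. dist x (Z i) = \<bar>u \<bullet> x - u \<bullet> M + a\<bar>}"
    by (rule parabola_eq[OF assms(6) Z a fr(1)])

  have r: "r > 0" and wH: "w \<in> H" using assms(7) unfolding is_twin_def by blast+
  have "\<bar>u \<bullet> w - u \<bullet> M\<bar> = r"
    using assms(7) fr(1) unfolding is_twin_def fr(10) by (intro tangent_to_line_dist) blast+
  moreover have "u \<bullet> w \<ge> u \<bullet> M"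
  proof -
    obtain K where K: "closed_half_plane {x. u \<bullet> x = u \<bullet> M} K" "Z i \<in> K" "sphere w r \<subseteq> K"
      using assms(7) unfolding is_twin_def fr(10) by blast
    have "u \<bullet> Z i > u \<bullet> M" using a fr(1) by (simp add: Z inner_add_right norm_eq_1)
    then show ?thesis
      using closed_half_plane_same_side[OF K(1,2)] center_in_closed_half_plane[OF K(1,3) fr(1) r]
      by blast
  qed
  ultimately have pw: "u \<bullet> w - u \<bullet> M = r" by linarith
  have "\<exists>T. ext_tangent_at w r (Z i) (R i) T" using assms(7) unfolding is_twin_def by blast
  then have dZ: "dist w (Z i) = r + a"
    using ext_tangent_dist(1)[OF _ r fr(4)] by (auto simp: a_def)
  obtain T where T: "int_tangent_at w r C (a + b) T"
    using assms(7) unfolding is_twin_def fr(6) a_def by blast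
  \<comment> \<open>The center \<open>C\<close> is on the boundary of \<open>H\<close>, so the two circles are not concentric.\<close>
  have "w \<noteq> C" using wH fr(3) by (auto simp: fr(11) C)
  then have "r < a + b"
    using T r unfolding int_tangent_at_def ball_subset_ball_iff zero_less_dist_iff[symmetric]
    by linarith
  then have dC: "dist w C = a + b - r" by (rule int_tangent_dist(1)[OF T r])
  have wEP: "w \<in> E" "w \<in> P" using a r by (simp_all add: E P dZ dC pw)

  have eq: "(x - M) \<bullet> u = a * b / (a + b)" "(x - M) \<bullet> v = sqrt (4 * a * (a * b / (a + b)))"
    if x: "x \<in> E" "x \<in> P" "x \<in> H" for x
  proof -
    define p q where "p = (x - M) \<bullet> u" and "q = (x - M) \<bullet> v"
    have xM: "x - M = p *\<^sub>R u + q *\<^sub>R v"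
      unfolding p_def q_def by (rule orthonormal_expansion_2[OF fr(1-3)])
    have "x - (M + t *\<^sub>R u) = (p - t) *\<^sub>R u + q *\<^sub>R v" for t
      using xM by (simp add: algebra_simps)
    then have dd: "(dist x (M + t *\<^sub>R u))\<^sup>2 = (p - t)\<^sup>2 + q\<^sup>2" for t
      by (simp add: dist_norm norm_orthonormal_combination[OF fr(1-3)])
    have up: "u \<bullet> x - u \<bullet> M = p" by (simp add: p_def inner_diff_right inner_commute)
    have "dist x (Z i) = \<bar>p + a\<bar>" "dist x C + dist x (Z i) = 2 * a + b"
      using x by (simp_all add: E P up)
    from parabola_ellipse_coords[OF a fr(5) dd[of a, folded Z] dd[of "a - b", folded C] this]
    have p: "p = a * b / (a + b)" and q: "q\<^sup>2 = 4 * a * p" .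
    show "(x - M) \<bullet> u = a * b / (a + b)" using p by (simp add: p_def)
    have "q > 0" using x(3) by (simp add: fr(11) q_def)
    then have "q = sqrt (4 * a * p)" unfolding q[symmetric] by simp
    then show "(x - M) \<bullet> v = sqrt (4 * a * (a * b / (a + b)))" unfolding p q_def .
  qed
  have "x = w" if x: "x \<in> E" "x \<in> P" "x \<in> H" for x
  proof -
    have "x - M = ((x - M) \<bullet> u) *\<^sub>R u + ((x - M) \<bullet> v) *\<^sub>R v"
      by (rule orthonormal_expansion_2[OF fr(1-3)])
    also have "\<dots> = ((w - M) \<bullet> u) *\<^sub>R u + ((w - M) \<bullet> v) *\<^sub>R v"
      by (simp only: eq[OF x] eq[OF wEP wH])
    also have "\<dots> = w - M"
      by (rule orthonormal_expansion_2[OF fr(1-3), symmetric])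
    finally show ?thesis by simp
  qed
  with wEP wH show ?thesis by blast
qed

end
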